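(* For every instance of (DAOC), the assortment $\bar S$ returned by Algorithm 1 (described in the context) is a $1/(\log K+2)$-approximation for (DAOC); that is, $\bar S$ satisfies $|\bar S\cap C_k|\ge \ell_k$ for all $k\in\{1,\dots,K\}$ and $$R(\bar S)\ \ge\ \frac{1}{\log K+2}\,\max\{R(S): S\subseteq\mathcal N,\ |S\cap C_k|\ge \ell_k\ \ \forall k\in\{1,\dots,K\}\}.$$
   Context: An instance of (DAOC) consists of products $\mathcal N=\{1,\dots,n\}$, revenues $r_i\ge 0$ and preference weights $v_i>0$ for $i\in\mathcal N$, $K\ge 1$ possibly overlapping categories $C_1,\dots,C_K\subseteq\mathcal N$, and integer thresholds $0\le\ell_k\le|C_k|$. For $S\subseteq\mathcal N$ let $$R(S)=\frac{\sum_{i\in S}r_iv_i}{1+\sum_{i\in S}v_i}.$$ (DAOC) is the problem of maximizing $R(S)$ over $S\subseteq\mathcal N$ subject to $|S\cap C_k|\ge\ell_k$ for all $k$. $\log$ is the natural logarithm. Algorithm 1. Step 1 (greedy weighted covering): start with $\hat S=\varnothing$. While there is some $k$ with $|\hat S\cap C_k|<\ell_k$: for each $i\in\mathcal N\setminus\hat S$ set $c_i=|\{k\in\{1,\dots,K\}: i\in C_k,\ |C_k\cap\hat S|<\ell_k\}|$, choose $i^*\in\arg\min_{i\in\mathcal N\setminus\hat S}v_i/c_i$ (with $v_i/c_i=\infty$ if $c_i=0$; ties broken arbitrarily), and replace $\hat S$ by $\hat S\cup\{i^*\}$. Step 2 (optimal expansion): return $\bar S\in\arg\max_{S\supseteq\hat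 S}R(S)$. *)

theory Defs
  imports Complex_Main "HOL-Library.Extended_Real"
begin

text \<open>
  Products are \<open>{1..n}\<close> and categories are indexed by \<open>{1..K}\<close>; values of \<open>r\<close>, \<open>v\<close>, \<open>C\<close>, \<open>l\<close>
  outside these index sets are never used.
\<close>

definition revenue :: "(nat \<Rightarrow> real) \<Rightarrow> (nat \<Rightarrow> real) \<Rightarrow> nat set \<Rightarrow> real" where
  "revenue r v S = (\<Sum>i\<in>S. r i * v i) / (1 + (\<Sum>i\<in>S. v i))"

definition meets_thresholds :: "nat \<Rightarrow> (nat \<Rightarrow> nat set) \<Rightarrow> (nat \<Rightarrow> nat) \<Rightarrow> nat set \<Rightarrow> bool" where
  "meets_thresholds K C l S \<longleftrightarrow> (\<forall>k\<in>{1..K}. card (S \<inter> C k) \<ge> l k)"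

definition unmet_count :: "nat \<Rightarrow> (nat \<Rightarrow> nat set) \<Rightarrow> (nat \<Rightarrow> nat) \<Rightarrow> nat set \<Rightarrow> nat \<Rightarrow> nat" where
  "unmet_count K C l S i = card {k \<in> {1..K}. i \<in> C k \<and> card (C k \<inter> S) < l k}"

definition greedy_ratio ::
  "nat \<Rightarrow> (nat \<Rightarrow> nat set) \<Rightarrow> (nat \<Rightarrow> nat) \<Rightarrow> (nat \<Rightarrow> real) \<Rightarrow> nat set \<Rightarrow> nat \<Rightarrow> ereal" where
  "greedy_ratio K C l v S i =
     (if unmet_count K C l S i = 0 then \<infinity> else ereal (v i / real (unmet_count K C l S i)))"

text \<open>
  The sets that can occur as the value of the greedy variable at some point of some run of
  the covering loop. Being a relation rather than a function, it admits every way of breaking ties.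
\<close>

inductive greedy_state ::
  "nat \<Rightarrow> nat \<Rightarrow> (nat \<Rightarrow> nat set) \<Rightarrow> (nat \<Rightarrow> nat) \<Rightarrow> (nat \<Rightarrow> real) \<Rightarrow> nat set \<Rightarrow> bool"
  for n K C l v where
  start: "greedy_state n K C l v {}"
| step: "\<lbrakk>greedy_state n K C l v S;
          \<exists>k\<in>{1..K}. card (S \<inter> C k) < l k;
          is_arg_min (greedy_ratio K C l v S) (\<lambda>i. i \<in> {1..n} - S) i\<rbrakk>
         \<Longrightarrow> greedy_state n K C l v (S \<union> {i})"

definition greedy_cover ::
  "nat \<Rightarrow> nat \<Rightarrow> (nat \<Rightarrow> nat set) \<Rightarrow> (nat \<Rightarrow> nat) \<Rightarrow> (nat \<Rightarrow> real) \<Rightarrow> nat set \<Rightarrow> bool" where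
  "greedy_cover n K C l v S \<longleftrightarrow>
     greedy_state n K C l v S \<and> \<not> (\<exists>k\<in>{1..K}. card (S \<inter> C k) < l k)"

definition algorithm1_returns ::
  "nat \<Rightarrow> nat \<Rightarrow> (nat \<Rightarrow> nat set) \<Rightarrow> (nat \<Rightarrow> nat) \<Rightarrow> (nat \<Rightarrow> real) \<Rightarrow> (nat \<Rightarrow> real)
     \<Rightarrow> nat set \<Rightarrow> bool" where
  "algorithm1_returns n K C l r v S \<longleftrightarrow>
     (\<exists>S0. greedy_cover n K C l v S0 \<and>
           is_arg_max (revenue r v) (\<lambda>T. S0 \<subseteq> T \<and> T \<subseteq> {1..n}) S)"

text \<open>
  The loop cannot get stuck, and since each iteration adds a new product, every run terminates
  with an output. Thus a statement about all returned assortments is not vacuous.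
\<close>

lemma greedy_state_subset:
  assumes "greedy_state n K C l v S"
  shows "S \<subseteq> {1..n}"
  using assms by induction (auto simp: is_arg_min_def)

lemma greedy_progress:
  assumes C: "\<And>k. k \<in> {1..K} \<Longrightarrow> C k \<subseteq> {1..n}"
    and l: "\<And>k. k \<in> {1..K} \<Longrightarrow> l k \<le> card (C k)"
    and S: "S \<subseteq> {1..n}"
    and ex: "\<exists>k\<in>{1..K}. card (S \<inter> C k) < l k"
  shows "\<exists>i. is_arg_min (greedy_ratio K C l v S) (\<lambda>i. i \<in> {1..n} - S) i"
proof -
  have "{1..n} - S \<noteq> {}"
  proof
    assume "{1..n} - S = {}"
    with S have "S = {1..n}" by auto
    then have "S \<inter> C k = C k" if "k \<in> {1..K}" for k using C[OF that] by auto
    with ex l show False by (metis not_less)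
  qed
  then obtain i where "is_arg_min (greedy_ratio K C l v S) (\<lambda>i. i \<in> {1..n} - S) i"
    using ex_is_arg_min_if_finite[of "{1..n} - S" "greedy_ratio K C l v S"] by auto
  then show ?thesis ..
qed

lemma algorithm1_returns_exists:
  assumes C: "\<And>k. k \<in> {1..K} \<Longrightarrow> C k \<subseteq> {1..n}"
    and l: "\<And>k. k \<in> {1..K} \<Longrightarrow> l k \<le> card (C k)"
  shows "\<exists>S. algorithm1_returns n K C l r v S"
proof -
  have "greedy_state n K C l v S \<Longrightarrow> \<exists>S0. greedy_cover n K C l v S0" for S
  proof (induction "n - card S" arbitrary: S rule: less_induct)
    case less
    show ?case
    proof (cases "\<exists>k\<in>{1..K}. card (S \<inter> C k) < l k")
      case False
      with less.prems show ?thesis unfolding greedy_cover_def by blast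
    next
      case True
      have sub: "S \<subseteq> {1..n}" using less.prems by (rule greedy_state_subset)
      obtain i where i: "is_arg_min (greedy_ratio K C l v S) (\<lambda>i. i \<in> {1..n} - S) i"
        using greedy_progress[OF C l sub True] by blast
      have st: "greedy_state n K C l v (S \<union> {i})"
        using less.prems True i by (rule greedy_state.step)
      have "i \<notin> S" using i by (auto simp: is_arg_min_def)
      then have "card (S \<union> {i}) = Suc (card S)"
        using finite_subset[OF sub] by simp
      moreover have "card (S \<union> {i}) \<le> n"
        using card_mono[OF _ greedy_state_subset[OF st]] by simp
      ultimately show ?thesis by (intro less.hyps[OF _ st]) linarith
    qed
  qed
  then obtain S0 where S0: "greedy_cover n K C l v S0" using greedy_state.start by blast
  then have sub: "S0 \<subseteq> {1..n}" using greedy_state_subset unfolding greedy_cover_def by blast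
  let ?A = "{T. S0 \<subseteq> T \<and> T \<subseteq> {1..n}}"
  have "finite ?A" by (rule finite_subset[of _ "Pow {1..n}"]) auto
  moreover have "?A \<noteq> {}" using sub by auto
  ultimately obtain S where "is_arg_min (\<lambda>T. - revenue r v T) (\<lambda>T. T \<in> ?A) S"
    using ex_is_arg_min_if_finite by blast
  then have "is_arg_max (revenue r v) (\<lambda>T. S0 \<subseteq> T \<and> T \<subseteq> {1..n}) S"
    by (simp add: is_arg_min_def is_arg_max_def)
  with S0 show ?thesis unfolding algorithm1_returns_def by blast
qed

end

theory Submission
  imports Defs "HOL-Analysis.Harmonic_Numbers"
begin

text \<open>
  Let \<open>F\<close> be a feasible assortment and write \<open>V\<close> for total weight. The heart of the matter is that
  greedy covering loses at most a harmonic factor: the covering set \<open>S0\<close> satisfies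
  \<open>V(S0) \<le> H\<^sub>K V(F) \<le> (ln K + 1) V(F)\<close>
  (\<open>greedy_cover_weight_le\<close>). Given this, \<open>F \<union> S0\<close> is a candidate of the expansion step; since
  revenues are nonnegative its numerator is at least that of \<open>F\<close>, and its denominator is at most
  \<open>1 + V(F) + V(S0) \<le> (ln K + 2) (1 + V(F))\<close>, so the best expansion earns at least the fraction
  \<open>1 / (ln K + 2)\<close> of the revenue of \<open>F\<close>.

  The harmonic bound is an amortized argument. Since a product counts only once, those products of
  \<open>F\<close> that greedy has already selected no longer bound its next price, and the cost of covering must
  be charged to the others. To keep track of them, each category \<open>k\<close> reserves a set
  \<open>D k\<close> of products of \<open>F \<inter> C k\<close> that are not yet selected, exactly as many as it is short of its
  threshold. A product \<open>j\<close> reserved by \<open>d\<close> categories holds the credit \<open>v j * H\<^sub>d\<close>. When greedy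
  selects \<open>i\<close>, each of the \<open>c\<close> unsatisfied categories containing \<open>i\<close> releases one reservation,
  that of \<open>i\<close> if it has one. By the greedy rule every release frees credit of at least \<open>v i / c\<close>, so
  the \<open>c\<close> releases together pay for \<open>i\<close>. The initial credit is at most \<open>H\<^sub>K V(F)\<close>.
\<close>

section \<open>Harmonic numbers\<close>

text \<open>Each of the \<open>n - m\<close> terms of the difference is at least \<open>1 / n\<close>.\<close>

lemma harm_diff_ge:
  fixes m n :: nat
  assumes "m \<le> n"
  shows "real (n - m) / real n \<le> harm n - (harm m :: real)"
  using assms
proof (induction n rule: dec_induct)
  case base
  show ?case by simp
next
  case (step n)
  have "real (Suc n - m) / real (Suc n) = real (n - m) / real (Suc n) + 1 / real (Suc n)"
    using step.hyps by (simp add: Suc_diff_le add_divide_distrib [symmetric])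
  also have "real (n - m) / real (Suc n) \<le> real (n - m) / real n"
    using step.hyps by (cases "n = 0") (auto intro!: divide_left_mono)
  also have "\<dots> \<le> harm n - harm m" by (rule step.IH)
  finally show ?case by (simp add: harm_Suc inverse_eq_divide)
qed

lemma harm_le_ln_plus_one:
  assumes "n > 0"
  shows "harm n \<le> ln (real n) + 1"
  using euler_mascheroni_sequence_decreasing [of 1 n] assms by (simp add: harm_def)

section \<open>Greedy covering\<close>

text \<open>
  The sets \<open>D k\<close> reserve, out of the products of \<open>F\<close> that are still available, exactly what each
  category needs to meet its threshold. When \<open>F\<close> is finite, truncated subtraction makes the
  reservations of satisfied categories empty.
\<close>

definition reservation ::
  "nat \<Rightarrow> (nat \<Rightarrow> nat set) \<Rightarrow> (nat \<Rightarrow> nat) \<Rightarrow> nat set \<Rightarrow> nat set \<Rightarrow> (nat \<Rightarrow> nat set) \<Rightarrow> bool" where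
  "reservation K C l F S D \<longleftrightarrow>
     (\<forall>k\<in>{1..K}. D k \<subseteq> F \<inter> C k - S \<and> card (D k) = l k - card (C k \<inter> S))"

definition reservation_count :: "nat \<Rightarrow> (nat \<Rightarrow> nat set) \<Rightarrow> nat \<Rightarrow> nat" where
  "reservation_count K D j = card {k \<in> {1..K}. j \<in> D k}"

definition credit :: "nat \<Rightarrow> (nat \<Rightarrow> real) \<Rightarrow> nat set \<Rightarrow> (nat \<Rightarrow> nat set) \<Rightarrow> real" where
  "credit K v F D = (\<Sum>j\<in>F. v j * harm (reservation_count K D j))"

lemma reservation_exists:
  assumes "meets_thresholds K C l F"
  shows "\<exists>D. reservation K C l F {} D"
proof -
  have "\<forall>k\<in>{1..K}. \<exists>E. E \<subseteq> F \<inter> C k \<and> card E = l k"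
    using assms unfolding meets_thresholds_def by (metis obtain_subset_with_card_n)
  then obtain D where "\<forall>k\<in>{1..K}. D k \<subseteq> F \<inter> C k \<and> card (D k) = l k"
    by metis
  then show ?thesis by (auto simp: reservation_def)
qed

lemma reserved_imp_unmet:
  assumes "reservation K C l F S D" "finite F" "k \<in> {1..K}" "j \<in> D k"
  shows "card (C k \<inter> S) < l k"
proof -
  have "finite (D k)"
    using assms(1-3) unfolding reservation_def by (meson finite_Diff finite_Int finite_subset)
  then have "card (D k) > 0" using assms(4) by (auto simp: card_gt_0_iff)
  then show ?thesis using assms(1,3) by (auto simp: reservation_def)
qed

lemma reservation_count_le_unmet_count:
  assumes "reservation K C l F S D" "finite F"
  shows "reservation_count K D j \<le> unmet_count K C l S j"
  unfolding reservation_count_def unmet_count_def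
proof (rule card_mono)
  show "{k \<in> {1..K}. j \<in> D k} \<subseteq> {k \<in> {1..K}. j \<in> C k \<and> card (C k \<inter> S) < l k}"
    using assms(1) reserved_imp_unmet [OF assms] by (auto simp: reservation_def)
qed simp

text \<open>
  The ratio is infinite on products that serve no unsatisfied category, so a single useful
  candidate forces the minimizer to be useful as well.
\<close>

lemma greedy_price_le:
  assumes min: "is_arg_min (greedy_ratio K C l v S) (\<lambda>i. i \<in> A) i"
    and j: "j \<in> A" "unmet_count K C l S j > 0"
  shows "unmet_count K C l S i > 0"
    and "v i / unmet_count K C l S i \<le> v j / unmet_count K C l S j"
proof -
  have le: "greedy_ratio K C l v S i \<le> greedy_ratio K C l v S j"
    using min j(1) by (auto simp: is_arg_min_def not_less)
  with j(2) show "unmet_count K C l S i > 0"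
    by (auto simp: greedy_ratio_def split: if_splits)
  with le j(2) show "v i / unmet_count K C l S i \<le> v j / unmet_count K C l S j"
    by (auto simp: greedy_ratio_def)
qed

text \<open>
  Releasing \<open>w\<close> of the \<open>d\<close> reservations of \<open>j\<close> lowers \<open>H\<^sub>d\<close> by at least \<open>w / d\<close>, and \<open>d\<close> is at most
  the number of unsatisfied categories containing \<open>j\<close>. Hence the credit freed is at least \<open>w\<close> times
  the ratio of \<open>j\<close>, which the greedy rule bounds from below by the ratio of the selected product.
\<close>

lemma greedy_step_credit:
  assumes F: "F \<subseteq> {1..n}"
    and v: "\<And>j. j \<in> F \<Longrightarrow> v j \<ge> 0"
    and res: "reservation K C l F S D"
    and unmet: "\<exists>k\<in>{1..K}. card (S \<inter> C k) < l k"
    and min: "is_arg_min (greedy_ratio K C l v S) (\<lambda>i. i \<in> {1..n} - S) i"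
    and S: "finite S"
  shows "\<exists>D'. reservation K C l F (S \<union> {i}) D' \<and> v i + credit K v F D' \<le> credit K v F D"
proof -
  have finF: "finite F" using F finite_subset by blast
  have iS: "i \<notin> S" using min by (auto simp: is_arg_min_def)
  define W where "W = {k \<in> {1..K}. i \<in> C k \<and> card (C k \<inter> S) < l k}"
  define p where "p = v i / real (card W)"
  have finW: "finite W" by (simp add: W_def)
  have price: "card W > 0 \<and> p \<le> v j / unmet_count K C l S j"
    if "k \<in> {1..K}" "j \<in> D k" for j k
  proof -
    have "j \<in> F \<inter> C k - S" using res that unfolding reservation_def by blast
    then have "j \<in> C k" "j \<in> {1..n} - S" using F by auto
    moreover have "unmet_count K C l S j > 0"
      unfolding unmet_count_def using that calculation(1) reserved_imp_unmet [OF res finF that]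
      by (auto simp: card_gt_0_iff)
    moreover have "unmet_count K C l S i = card W" by (simp add: unmet_count_def W_def)
    ultimately show ?thesis
      using greedy_price_le [OF min, of j] by (simp add: p_def)
  qed
  have nonempty: "D k \<noteq> {}" if "k \<in> {1..K}" "card (C k \<inter> S) < l k" for k
  proof -
    have "card (D k) = l k - card (C k \<inter> S)" using res that(1) unfolding reservation_def by blast
    with that(2) show ?thesis by auto
  qed
  have Wpos: "card W > 0"
    using unmet nonempty price by (metis Int_commute ex_in_conv)
  have "\<forall>k\<in>W. \<exists>x. x \<in> D k \<and> (i \<in> D k \<longrightarrow> x = i)"
    using nonempty unfolding W_def by blast
  \<comment> \<open>If \<open>i\<close> is reserved, precisely this reservation must go, as \<open>i\<close> ceases to be available.\<close>
  then obtain e where e: "\<And>k. k \<in> W \<Longrightarrow> e k \<in> D k" "\<And>k. k \<in> W \<Longrightarrow> i \<in> D k \<Longrightarrow> e k = i"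
    by metis
  define D' where "D' k = (if k \<in> W then D k - {e k} else D k)" for k
  define w where "w j = card {k \<in> W. e k = j}" for j
  have "reservation K C l F (S \<union> {i}) D'"
    unfolding reservation_def
  proof (intro ballI conjI)
    fix k assume k: "k \<in> {1..K}"
    have Dk: "D k \<subseteq> F \<inter> C k - S" "card (D k) = l k - card (C k \<inter> S)"
      using res k by (auto simp: reservation_def)
    have "k \<in> W" if "i \<in> D k"
      using that k Dk(1) reserved_imp_unmet [OF res finF k that] by (auto simp: W_def)
    then have "i \<notin> D' k" using e(2) by (auto simp: D'_def)
    with Dk(1) show "D' k \<subseteq> F \<inter> C k - (S \<union> {i})"
      by (auto simp: D'_def split: if_splits)
    show "card (D' k) = l k - card (C k \<inter> (S \<union> {i}))"
    proof (cases "i \<in> C k")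
      case False
      then have "C k \<inter> (S \<union> {i}) = C k \<inter> S" "k \<notin> W" by (auto simp: W_def)
      then show ?thesis using Dk(2) by (simp add: D'_def)
    next
      case True
      then have "C k \<inter> (S \<union> {i}) = insert i (C k \<inter> S)" by auto
      then have "card (C k \<inter> (S \<union> {i})) = Suc (card (C k \<inter> S))"
        using S iS by simp
      moreover have "card (D' k) = card (D k) - (if k \<in> W then 1 else 0)"
        using e(1) by (simp add: D'_def)
      ultimately show ?thesis
        using Dk(2) k True by (auto simp: W_def)
    qed
  qed
  moreover have "v i + credit K v F D' \<le> credit K v F D"
  proof -
    have count: "reservation_count K D j = reservation_count K D' j + w j" for j
    proof -
      have "{k \<in> {1..K}. j \<in> D k} = {k \<in> {1..K}. j \<in> D' k} \<union> {k \<in> W. e k = j}"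
        using e(1) by (auto simp: D'_def W_def)
      moreover have "{k \<in> {1..K}. j \<in> D' k} \<inter> {k \<in> W. e k = j} = {}"
        by (auto simp: D'_def)
      ultimately show ?thesis
        unfolding reservation_count_def w_def using finW by (simp add: card_Un_disjoint)
    qed
    have freed: "p * w j + v j * harm (reservation_count K D' j)
                   \<le> v j * harm (reservation_count K D j)" if jF: "j \<in> F" for j
    proof (cases "w j = 0")
      case True
      then show ?thesis by (simp add: count)
    next
      case False
      let ?d = "reservation_count K D j" and ?d' = "reservation_count K D' j"
      let ?c = "unmet_count K C l S j"
      obtain k where "k \<in> W" "e k = j"
        using False unfolding w_def by (metis (mono_tags, lifting) card.empty empty_Collect_eq)
      then have "k \<in> {1..K}" "j \<in> D k" using e(1) by (auto simp: W_def)
      then have p: "p \<le> v j / ?c" using price by blast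
      have vj: "v j \<ge> 0" using jF by (rule v)
      have d: "0 < ?d" "?d \<le> ?c" "?d - ?d' = w j"
        using False reservation_count_le_unmet_count [OF res finF] by (auto simp: count)
      have "p \<le> v j / ?d"
        using p d vj by (elim order_trans) (intro divide_left_mono, auto)
      then have "p * w j \<le> v j / ?d * w j" by (intro mult_right_mono) auto
      also have "\<dots> = v j * (real (?d - ?d') / ?d)" by (simp add: d(3))
      also have "\<dots> \<le> v j * (harm ?d - harm ?d')"
        using vj by (intro mult_left_mono harm_diff_ge) (auto simp: count)
      finally show ?thesis by (simp add: right_diff_distrib)
    qed
    have "(\<Sum>j\<in>F. w j) = card W"
    proof -
      have "e ` W \<subseteq> F" using e(1) res unfolding reservation_def W_def by blast
      then show ?thesis
        using sum.group [OF finW finF, of e "\<lambda>_. 1 :: nat"] by (simp add: w_def)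
    qed
    then have "v i = p * (\<Sum>j\<in>F. w j)" using Wpos by (simp add: p_def)
    then have "v i + credit K v F D'
                 = (\<Sum>j\<in>F. p * w j + v j * harm (reservation_count K D' j))"
      by (simp add: credit_def sum.distrib sum_distrib_left)
    also have "\<dots> \<le> credit K v F D"
      unfolding credit_def by (intro sum_mono freed)
    finally show ?thesis .
  qed
  ultimately show ?thesis by blast
qed

text \<open>
  The weight bought so far plus the outstanding credit never increases along a run. At the start
  no weight is bought, and a product is reserved by at most \<open>K\<close> categories.
\<close>

lemma greedy_state_credit:
  assumes "greedy_state n K C l v S"
    and F: "F \<subseteq> {1..n}" "meets_thresholds K C l F"
    and v: "\<And>j. j \<in> F \<Longrightarrow> v j \<ge> 0"
  shows "\<exists>D. reservation K C l F S D \<and> sum v S + credit K v F D \<le> harm K * sum v F"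
  using assms(1)
proof induction
  case start
  obtain D where D: "reservation K C l F {} D" using reservation_exists [OF F(2)] by blast
  have "reservation_count K D j \<le> K" for j
    unfolding reservation_count_def by (rule order_trans [OF card_mono [of "{1..K}"]]) auto
  then have "credit K v F D \<le> (\<Sum>j\<in>F. v j * harm K)"
    unfolding credit_def by (intro sum_mono mult_left_mono harm_mono v)
  with D show ?case by (auto simp: sum_distrib_left mult.commute)
next
  case (step S i)
  then obtain D where D: "reservation K C l F S D"
    "sum v S + credit K v F D \<le> harm K * sum v F" by blast
  have S: "finite S" using greedy_state_subset [OF step.hyps(1)] finite_subset by blast
  obtain D' where D': "reservation K C l F (S \<union> {i}) D'"
    "v i + credit K v F D' \<le> credit K v F D"
    using greedy_step_credit [OF F(1) v D(1) step.hyps(2,3) S] by blast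
  have "i \<notin> S" using step.hyps(3) by (auto simp: is_arg_min_def)
  then have "sum v (S \<union> {i}) = v i + sum v S" using S by simp
  with D(2) D' show ?case by (intro exI [of _ D']) auto
qed

lemma greedy_cover_weight_le:
  assumes "greedy_state n K C l v S"
    and F: "F \<subseteq> {1..n}" "meets_thresholds K C l F"
    and v: "\<And>j. j \<in> F \<Longrightarrow> v j \<ge> 0"
  shows "sum v S \<le> harm K * sum v F"
proof -
  obtain D where D: "sum v S + credit K v F D \<le> harm K * sum v F"
    using greedy_state_credit [OF assms] by blast
  have "credit K v F D \<ge> 0"
    unfolding credit_def by (intro sum_nonneg mult_nonneg_nonneg harm_nonneg v)
  with D show ?thesis by linarith
qed

section \<open>Expansion of the cover\<close>

text \<open>
  Adding a set of weight at most \<open>a V(F)\<close> dilutes the sales of \<open>F\<close>, but scales the denominator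
  \<open>1 + V(F)\<close> by no more than \<open>a + 1\<close>.
\<close>

lemma revenue_Un_ge:
  assumes fin: "finite F" "finite S"
    and r: "\<And>i. i \<in> F \<union> S \<Longrightarrow> r i \<ge> 0"
    and v: "\<And>i. i \<in> F \<union> S \<Longrightarrow> v i \<ge> 0"
    and a: "a \<ge> 0" "sum v S \<le> a * sum v F"
  shows "revenue r v F / (a + 1) \<le> revenue r v (F \<union> S)"
proof -
  have VF: "sum v F \<ge> 0" using v by (intro sum_nonneg) auto
  have "sum v (F \<union> S) \<le> sum v F + sum v S"
    using sum.union_inter [OF fin, of v] sum_nonneg [of "F \<inter> S" v] v by force
  also have "\<dots> \<le> (a + 1) * sum v F" using a(2) by (simp add: algebra_simps)
  finally have den: "1 + sum v (F \<union> S) \<le> (1 + sum v F) * (a + 1)"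
    using a(1) by (simp add: algebra_simps)
  have num: "(\<Sum>i\<in>F. r i * v i) \<le> (\<Sum>i\<in>F \<union> S. r i * v i)"
    using fin r v by (intro sum_mono2) auto
  have "revenue r v F / (a + 1) = (\<Sum>i\<in>F. r i * v i) / ((1 + sum v F) * (a + 1))"
    by (simp add: revenue_def)
  also have "\<dots> \<le> revenue r v (F \<union> S)"
    unfolding revenue_def using r v
    by (intro frac_le num den sum_nonneg) (auto intro!: add_pos_nonneg sum_nonneg)
  finally show ?thesis .
qed

lemma meets_thresholds_mono:
  assumes "meets_thresholds K C l S" "S \<subseteq> T" "finite T"
  shows "meets_thresholds K C l T"
  unfolding meets_thresholds_def
proof
  fix k assume "k \<in> {1..K}"
  then have "l k \<le> card (S \<inter> C k)" using assms(1) by (auto simp: meets_thresholds_def)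
  also have "\<dots> \<le> card (T \<inter> C k)" using assms(2,3) by (intro card_mono) auto
  finally show "l k \<le> card (T \<inter> C k)" .
qed

section \<open>The approximation guarantee\<close>

theorem theorem2:
  fixes n K :: nat
    and r v :: "nat \<Rightarrow> real"
    and C :: "nat \<Rightarrow> nat set"
    and l :: "nat \<Rightarrow> nat"
    and Sbar :: "nat set"
  assumes "\<And>i. i \<in> {1..n} \<Longrightarrow> r i \<ge> 0"
    and "\<And>i. i \<in> {1..n} \<Longrightarrow> v i > 0"
    and "K \<ge> 1"
    and "\<And>k. k \<in> {1..K} \<Longrightarrow> C k \<subseteq> {1..n}"
    and "\<And>k. k \<in> {1..K} \<Longrightarrow> l k \<le> card (C k)"
    and "algorithm1_returns n K C l r v Sbar"
  shows "meets_thresholds K C l Sbar \<and>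
         revenue r v Sbar \<ge> 1 / (ln (real K) + 2) *
           Max {revenue r v S | S. S \<subseteq> {1..n} \<and> meets_thresholds K C l S}"
proof -
  let ?M = "{revenue r v S | S. S \<subseteq> {1..n} \<and> meets_thresholds K C l S}"
  obtain S0 where cover: "greedy_cover n K C l v S0"
    and best: "is_arg_max (revenue r v) (\<lambda>T. S0 \<subseteq> T \<and> T \<subseteq> {1..n}) Sbar"
    using assms(6) by (auto simp: algorithm1_returns_def)
  have state: "greedy_state n K C l v S0" and S0: "meets_thresholds K C l S0"
    using cover by (auto simp: greedy_cover_def meets_thresholds_def not_less)
  have S0_sub: "S0 \<subseteq> {1..n}" by (rule greedy_state_subset [OF state])
  have Sbar: "S0 \<subseteq> Sbar" "Sbar \<subseteq> {1..n}" using best by (auto simp: is_arg_max_def)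
  have feasible: "meets_thresholds K C l Sbar"
    using S0 Sbar(1) finite_subset [OF Sbar(2)] by (rule meets_thresholds_mono) simp
  have "finite ?M"
    by (rule finite_subset [of _ "revenue r v ` Pow {1..n}"]) auto
  moreover have "?M \<noteq> {}" using feasible Sbar(2) by blast
  ultimately have "Max ?M \<in> ?M" by (rule Max_in)
  then obtain F where F: "F \<subseteq> {1..n}" "meets_thresholds K C l F"
    and opt: "Max ?M = revenue r v F" by auto
  have ln: "ln (real K) \<ge> 0" using assms(3) by simp
  have v: "v i \<ge> 0" if "i \<in> F \<union> S0" for i
    using that F(1) S0_sub assms(2) [of i] by (auto intro: less_imp_le)
  then have "sum v F \<ge> 0" by (intro sum_nonneg) auto
  then have weight: "sum v S0 \<le> (ln (real K) + 1) * sum v F"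
    using greedy_cover_weight_le [OF state F v] assms(3)
      mult_right_mono [OF harm_le_ln_plus_one [of K], of "sum v F"] by fastforce
  have "1 / (ln (real K) + 2) * Max ?M = revenue r v F / (ln (real K) + 1 + 1)"
    unfolding opt by (simp add: add.commute)
  also have "\<dots> \<le> revenue r v (F \<union> S0)"
  proof (rule revenue_Un_ge [OF _ _ _ _ _ weight])
    show "finite F" "finite S0" using F(1) S0_sub finite_subset by blast+
    show "r i \<ge> 0" if "i \<in> F \<union> S0" for i
      using that F(1) S0_sub assms(1) by blast
  qed (use ln v in auto)
  also have "\<dots> \<le> revenue r v Sbar"
    using best F(1) S0_sub by (auto simp: is_arg_max_def not_less)
  finally show ?thesis using feasible by blast
qed

end
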